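(* A finite interval order $P=(X,\prec)$ is a unit OC interval order if and only if it contains no induced subposet isomorphic to any of the posets $\mathbf{4}+\mathbf{1}$, $D^*$, $Z$, $Y^*$, $Y^{**}$, or the duals of these five posets.
   Context: Posets are strict (irreflexive) partial orders; twins are allowed. $P$ is an interval order if each $x$ can be assigned a closed real interval $[L(x),R(x)]$ with $x\prec y$ iff $R(x)<L(y)$. An OC interval representation assigns to each $x$ a real interval $I(x)$ that is either open or closed such that $x\prec y$ iff every point of $I(x)$ is less than every point of $I(y)$; $P$ is a unit OC interval order if it has such a representation with all intervals of equal length. In the following posets, comparabilities are the listed ones together with their transitive consequences, and all other pairs are incomparable. $\mathbf{4}+\mathbf{1}$: elements $a,b,c,d,x$ with $a\prec b\prec c\prec d$. $D^*$: elements $a,b,c,d,x,y$ with $a\prec b\prec d$, $a\prec c\prec d$, $y\prec c$. $Z$: elements $a,b,c,d,x,y$ with $a\prec b\prec c\prec d$, $x\prec d$, $a\prec y$. $Y^*$: elements $a,d,p,c,q,b$ with $a\prec d\prec p\prec c$, $q\prec c$, $d\prec b$. $Y^{**}$: elements $a,b,c,d,x,y$ with $a\prec d\prec b$, $a\prec d\prec c$, $y\prec c$. The dual of a poset reverses all comparabilities. *)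

theory Defs
  imports Complex_Main
begin

definition strict_po :: "'a set \<Rightarrow> ('a \<Rightarrow> 'a \<Rightarrow> bool) \<Rightarrow> bool" where
  "strict_po X lt \<longleftrightarrow> (\<forall>x\<in>X. \<not> lt x x) \<and>
     (\<forall>x\<in>X. \<forall>y\<in>X. \<forall>z\<in>X. lt x y \<longrightarrow> lt y z \<longrightarrow> lt x z)"

definition interval_order :: "'a set \<Rightarrow> ('a \<Rightarrow> 'a \<Rightarrow> bool) \<Rightarrow> bool" where
  "interval_order X lt \<longleftrightarrow> (\<exists>L R :: 'a \<Rightarrow> real.
     (\<forall>x\<in>X. L x \<le> R x) \<and> (\<forall>x\<in>X. \<forall>y\<in>X. lt x y \<longleftrightarrow> R x < L y))"

definition oc_interval :: "bool \<Rightarrow> real \<Rightarrow> real \<Rightarrow> real set" where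
  "oc_interval c l r = (if c then {l..r} else {l<..<r})"

definition unit_OC_interval_order :: "'a set \<Rightarrow> ('a \<Rightarrow> 'a \<Rightarrow> bool) \<Rightarrow> bool" where
  "unit_OC_interval_order X lt \<longleftrightarrow> (\<exists>(l :: 'a \<Rightarrow> real) (c :: 'a \<Rightarrow> bool).
     (\<forall>x\<in>X. \<forall>y\<in>X. lt x y \<longleftrightarrow>
        (\<forall>p\<in>oc_interval (c x) (l x) (l x + 1). \<forall>q\<in>oc_interval (c y) (l y) (l y + 1). p < q)))"

text \<open>A small poset on {0..<n}, given by generating comparabilities; its order is the
  transitive closure of the generators.\<close>
type_synonym small_poset = "nat \<times> (nat \<times> nat) list"

definition dual_poset :: "small_poset \<Rightarrow> small_poset" where
  "dual_poset Q = (fst Q, map prod.swap (snd Q))"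

definition contains_induced :: "'a set \<Rightarrow> ('a \<Rightarrow> 'a \<Rightarrow> bool) \<Rightarrow> small_poset \<Rightarrow> bool" where
  "contains_induced X lt Q \<longleftrightarrow> (\<exists>f :: nat \<Rightarrow> 'a.
     inj_on f {0..<fst Q} \<and> f ` {0..<fst Q} \<subseteq> X \<and>
     (\<forall>u<fst Q. \<forall>v<fst Q. ((u, v) \<in> (set (snd Q))\<^sup>+ \<longleftrightarrow> lt (f u) (f v))))"

text \<open>4+1: a=0,b=1,c=2,d=3,x=4.\<close>
definition four_plus_one :: small_poset where
  "four_plus_one = (5, [(0,1),(1,2),(2,3)])"

text \<open>D*: a=0,b=1,c=2,d=3,x=4,y=5.\<close>
definition D_star :: small_poset where
  "D_star = (6, [(0,1),(1,3),(0,2),(2,3),(5,2)])"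

text \<open>Z: a=0,b=1,c=2,d=3,x=4,y=5.\<close>
definition Z_poset :: small_poset where
  "Z_poset = (6, [(0,1),(1,2),(2,3),(4,3),(0,5)])"

text \<open>Y*: a=0,d=1,p=2,c=3,q=4,b=5.\<close>
definition Y_star :: small_poset where
  "Y_star = (6, [(0,1),(1,2),(2,3),(4,3),(1,5)])"

text \<open>Y**: a=0,b=1,c=2,d=3,x=4,y=5.\<close>
definition Y_star_star :: small_poset where
  "Y_star_star = (6, [(0,3),(3,1),(3,2),(5,2)])"

end

theory Submission
  imports Defs
begin

text \<open>In a unit OC representation, three elements \<open>z \<prec> x \<prec> y\<close> all incomparable to \<open>u\<close> are
  rigid: \<open>x\<close> is the open and \<open>u\<close> the closed interval on the same endpoints, and \<open>z\<close>, \<open>y\<close> are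
  closed and touch \<open>u\<close>. Each forbidden poset contradicts this rigidity.

  Conversely, call \<open>x\<close> inside \<open>u\<close> if it is the middle of such a \<open>3+1\<close>. In the absence of the
  forbidden posets, nothing is inside an element that is itself inside another, and all elements
  inside \<open>u\<close> are twins. So \<open>X\<close> splits into classes, each consisting of uncontained twins (made
  closed) and the elements inside them (made open); the classes are linearly ordered, since two
  uncontained elements that are not twins have strictly comparable endpoints. The remaining
  forbidden posets say that between two classes the required distance is consistently
  smaller than, equal to or larger than 1, where a distance \<open>\<ge> 1\<close> becomes \<open>> 1\<close> as soon as one
  of the two classes is moved outwards. Under this monotonicity the left endpoints can be chosen
  greedily from left to right.\<close>

section \<open>Unit OC representations\<close>

lemma oc_interval_less_iff:
  "(\<forall>p\<in>oc_interval c l (l + 1). \<forall>q\<in>oc_interval c' l' (l' + 1). p < q) \<longleftrightarrow>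
     (if c \<and> c' then l + 1 < l' else l + 1 \<le> l')" (is "?A \<longleftrightarrow> ?B")
proof
  assume A: ?A
  have "l + 1 \<le> l'"
  proof (rule ccontr)
    assume neg: "\<not> l + 1 \<le> l'"
    \<comment> \<open>With \<open>0 < e < 1\<close> the points \<open>l + 1 - e\<close> and
      \<open>l' + e\<close> lie in their intervals even if these are open, and
      \<open>2 * e \<le> l + 1 - l'\<close> puts them in the wrong order.\<close>
    define e where "e = min ((l + 1 - l') / 2) (1 / 2)"
    have e: "0 < e" "e < 1" "2 * e \<le> l + 1 - l'"
      using neg by (auto simp: e_def min_def field_simps)
    have "l + 1 - e < l' + e"
      using A e by (auto simp: oc_interval_def split: if_splits)
    with e show False by simp
  qed
  moreover have "l + 1 < l'" if "c" "c'"
    using A that by (auto simp: oc_interval_def)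
  ultimately show ?B by simp
next
  assume ?B
  then show ?A by (auto simp: oc_interval_def split: if_splits)
qed

definition unit_rep :: "'a set \<Rightarrow> ('a \<Rightarrow> 'a \<Rightarrow> bool) \<Rightarrow> ('a \<Rightarrow> real) \<Rightarrow> ('a \<Rightarrow> bool) \<Rightarrow> bool" where
  "unit_rep X lt l c \<longleftrightarrow> (\<forall>x\<in>X. \<forall>y\<in>X. lt x y \<longleftrightarrow>
     (if c x \<and> c y then l x + 1 < l y else l x + 1 \<le> l y))"

lemma unit_OC_interval_order_iff_unit_rep:
  "unit_OC_interval_order X lt \<longleftrightarrow> (\<exists>l c. unit_rep X lt l c)"
  unfolding unit_OC_interval_order_def unit_rep_def oc_interval_less_iff ..

text \<open>Reflection sends the left endpoint \<open>l x\<close> to \<open>- l x - 1\<close>; the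
  common summand is dropped.\<close>

lemma unit_rep_dual:
  assumes "unit_rep X lt l c"
  shows "unit_rep X (\<lambda>x y. lt y x) (\<lambda>x. - l x) c"
  unfolding unit_rep_def
proof (intro ballI)
  fix x y assume "x \<in> X" "y \<in> X"
  then have "lt y x \<longleftrightarrow> (if c y \<and> c x then l y + 1 < l x else l y + 1 \<le> l x)"
    using assms unfolding unit_rep_def by blast
  then show "lt y x \<longleftrightarrow> (if c x \<and> c y then - l x + 1 < - l y else - l x + 1 \<le> - l y)"
    by auto
qed

section \<open>Induced subposets\<close>

lemma contains_induced_dual:
  "contains_induced X lt (dual_poset Q) \<longleftrightarrow> contains_induced X (\<lambda>x y. lt y x) Q"
proof -
  have "set (map prod.swap (snd Q)) = (set (snd Q))\<inverse>"
    by force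
  then have *: "(u, v) \<in> (set (map prod.swap (snd Q)))\<^sup>+ \<longleftrightarrow> (v, u) \<in> (set (snd Q))\<^sup>+" for u v
    by (simp add: trancl_converse)
  show ?thesis
    unfolding contains_induced_def dual_poset_def fst_conv snd_conv *
    by (rule ex_cong1) metis
qed

lemma trancl_four_plus_one:
  "(set (snd four_plus_one))\<^sup>+ = {(0,1),(1,2),(2,3),(0,2),(1,3),(0,3)}"
  by code_simp

lemma trancl_D_star:
  "(set (snd D_star))\<^sup>+ = {(0,1),(1,3),(0,2),(2,3),(5,2),(0,3),(5,3)}"
  by code_simp

lemma trancl_Z_poset:
  "(set (snd Z_poset))\<^sup>+ = {(0,1),(1,2),(2,3),(0,2),(1,3),(0,3),(4,3),(0,5)}"
  by code_simp

lemma trancl_Y_star: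
  "(set (snd Y_star))\<^sup>+ = {(0,1),(1,2),(2,3),(0,2),(1,3),(0,3),(4,3),(1,5),(0,5)}"
  by code_simp

lemma trancl_Y_star_star:
  "(set (snd Y_star_star))\<^sup>+ = {(0,3),(3,1),(3,2),(5,2),(0,1),(0,2)}"
  by code_simp

lemmas trancl_forbidden =
  trancl_four_plus_one trancl_D_star trancl_Z_poset trancl_Y_star trancl_Y_star_star

lemma fst_forbidden:
  "fst four_plus_one = 5" "fst D_star = 6" "fst Z_poset = 6" "fst Y_star = 6" "fst Y_star_star = 6"
  by (simp_all add: four_plus_one_def D_star_def Z_poset_def Y_star_def Y_star_star_def)

lemma all_less_5_6: "(\<forall>u<5::nat. P u) \<longleftrightarrow> P 0 \<and> P 1 \<and> P 2 \<and> P 3 \<and> P 4"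
  "(\<forall>u<6::nat. P u) \<longleftrightarrow> P 0 \<and> P 1 \<and> P 2 \<and> P 3 \<and> P 4 \<and> P 5"
  by (auto simp: eval_nat_numeral All_less_Suc)

lemma contains_induced_listI:
  assumes "fst Q = length xs" "distinct xs" "set xs \<subseteq> X"
    and "\<forall>u<fst Q. \<forall>v<fst Q. (u, v) \<in> (set (snd Q))\<^sup>+ \<longleftrightarrow> lt (xs ! u) (xs ! v)"
  shows "contains_induced X lt Q"
  unfolding contains_induced_def
proof (intro exI[of _ "(!) xs"] conjI)
  show "inj_on ((!) xs) {0..<fst Q}"
    using assms(1,2) by (simp add: inj_on_nth)
  show "(!) xs ` {0..<fst Q} \<subseteq> X"
    using assms(1,3) by auto
qed (use assms(1,4) in auto)

section \<open>Necessity\<close>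

text \<open>The chain gives \<open>l a + 2 \<le> l d\<close>, the two negated relations give
  \<open>l d \<le> l x + 1 \<le> l a + 2\<close>, so every bound is tight. At distance exactly 1,
  not being less means that both intervals are closed, and being less that one is open.\<close>

lemma unit_rep_three_plus_one:
  assumes "unit_rep X lt l c" "a \<in> X" "b \<in> X" "d \<in> X" "x \<in> X"
    and "lt a b" "lt b d" "\<not> lt a x" "\<not> lt x d"
  shows "l b = l x \<and> l a + 1 = l x \<and> l x + 1 = l d \<and> c a \<and> \<not> c b \<and> c d \<and> c x"
proof -
  have lt: "lt u v \<longleftrightarrow> (if c u \<and> c v then l u + 1 < l v else l u + 1 \<le> l v)"
    if "u \<in> X" "v \<in> X" for u v
    using assms(1) that unfolding unit_rep_def by blast
  show ?thesis
    using lt[of a b] lt[of b d] lt[of a x] lt[of x d] assms(2-) by (auto split: if_splits)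
qed

text \<open>Rigidity is applied to two copies of 3+1 in each poset. In 4+1 it gives the chain
  members b and c the same left endpoint. In D* and Y** the elements b and c, and in Y* the elements
  p and b, get the same endpoint and type, although a further element is comparable to only one of
  them. In Z the element b would be both open and closed.\<close>

lemma unit_rep_not_contains:
  assumes rep: "unit_rep X lt l c"
    and Q: "Q \<in> {four_plus_one, D_star, Z_poset, Y_star, Y_star_star}"
  shows "\<not> contains_induced X lt Q"
proof
  assume "contains_induced X lt Q"
  then obtain f where f: "\<forall>u<fst Q. f u \<in> X"
    "\<forall>u<fst Q. \<forall>v<fst Q. ((u, v) \<in> (set (snd Q))\<^sup>+ \<longleftrightarrow> lt (f u) (f v))"
    unfolding contains_induced_def by fastforce
  have lt: "lt x y \<longleftrightarrow> (if c x \<and> c y then l x + 1 < l y else l x + 1 \<le> l y)"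
    if "x \<in> X" "y \<in> X" for x y
    using rep that unfolding unit_rep_def by blast
  note One_nat_def [simp del]
  note tp = unit_rep_three_plus_one[OF rep]
  consider "Q = four_plus_one" | "Q = D_star" | "Q = Z_poset" | "Q = Y_star" | "Q = Y_star_star"
    using Q by blast
  then show False
  proof cases
    case 1
    note g = f[unfolded 1 fst_forbidden trancl_forbidden all_less_5_6, simplified]
    note t = tp[of "f 0" "f 1" "f 2" "f 4"]
      tp[of "f 1" "f 2" "f 3" "f 4"]
    show ?thesis
      using t g by (auto split: if_splits)
  next
    case 2
    note g = f[unfolded 2 fst_forbidden trancl_forbidden all_less_5_6, simplified]
    note t = tp[of "f 0" "f 1" "f 3" "f 4"]
      tp[of "f 0" "f 2" "f 3" "f 4"]
    show ?thesis
      using t g lt[of "f 5" "f 1"] lt[of "f 5" "f 2"] by (auto split: if_splits)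
  next
    case 3
    note g = f[unfolded 3 fst_forbidden trancl_forbidden all_less_5_6, simplified]
    note t = tp[of "f 0" "f 1" "f 2" "f 4"]
      tp[of "f 1" "f 2" "f 3" "f 5"]
    show ?thesis
      using t g by (auto split: if_splits)
  next
    case 4
    note g = f[unfolded 4 fst_forbidden trancl_forbidden all_less_5_6, simplified]
    note t = tp[of "f 0" "f 1" "f 2" "f 4"]
      tp[of "f 0" "f 1" "f 5" "f 4"]
    show ?thesis
      using t g lt[of "f 5" "f 3"] lt[of "f 2" "f 3"] by (auto split: if_splits)
  next
    case 5
    note g = f[unfolded 5 fst_forbidden trancl_forbidden all_less_5_6, simplified]
    note t = tp[of "f 0" "f 3" "f 1" "f 4"]
      tp[of "f 0" "f 3" "f 2" "f 4"]
    show ?thesis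
      using t g lt[of "f 5" "f 1"] lt[of "f 5" "f 2"] by (auto split: if_splits)
  qed
qed

section \<open>Interval orders without the forbidden posets\<close>

text \<open>The inequalities below imply all comparabilities and incomparabilities of the respective
  poset, so each assumption is only as strong as excluding the induced poset.\<close>
locale forbidden_free_half =
  fixes X :: "'a set" and L R :: "'a \<Rightarrow> real"
  assumes fin: "finite X"
    and LR: "x \<in> X \<Longrightarrow> L x \<le> R x"
    and no_4_1: "\<lbrakk>a \<in> X; b \<in> X; c \<in> X; d \<in> X; x \<in> X; R a < L b; R b < L c; R c < L d;
      L x \<le> R a; L d \<le> R x\<rbrakk> \<Longrightarrow> False"
    and no_D_star: "\<lbrakk>a \<in> X; b \<in> X; c \<in> X; d \<in> X; x \<in> X; y \<in> X; R a < L b; L b \<le> R y; R y < L c;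
      L c \<le> R b; R b < L d; R c < L d; L y \<le> R a; L x \<le> R a; L d \<le> R x\<rbrakk> \<Longrightarrow> False"
    and no_Z: "\<lbrakk>a \<in> X; b \<in> X; c \<in> X; d \<in> X; x \<in> X; y \<in> X; R a < L b; R b < L c; R c < L d;
      R x < L d; L c \<le> R x; L x \<le> R a; R a < L y; L y \<le> R b; L d \<le> R y\<rbrakk> \<Longrightarrow> False"
    and no_Y_star: "\<lbrakk>a \<in> X; b \<in> X; c \<in> X; d \<in> X; p \<in> X; q \<in> X; R a < L d; R d < L p; R p < L c;
      R q < L c; L p \<le> R q; L q \<le> R a; R d < L b; L b \<le> R p; L c \<le> R b; L b \<le> R q\<rbrakk> \<Longrightarrow> False"
    and no_Y_star_star: "\<lbrakk>a \<in> X; b \<in> X; c \<in> X; d \<in> X; x \<in> X; y \<in> X; R a < L d; R d < L b; R d < L c;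
      R y < L c; L b \<le> R y; L c \<le> R b; L y \<le> R a; L x \<le> R a; L b \<le> R x; L c \<le> R x\<rbrakk> \<Longrightarrow> False"
begin

text \<open>Here \<open>L u \<le> R z < L x\<close> and \<open>R x < L y \<le> R u\<close>: a strict
  containment at both ends that is witnessed by elements of the order.\<close>

definition inside :: "'a \<Rightarrow> 'a \<Rightarrow> bool" where
  "inside x u \<longleftrightarrow> (\<exists>z\<in>X. \<exists>y\<in>X. R z < L x \<and> R x < L y \<and> L u \<le> R z \<and> L y \<le> R u)"

text \<open>Endpoints are compared through predecessor and successor sets, because the given \<open>L\<close> and
  \<open>R\<close> may distinguish endpoints that the order does not.\<close>
definition left_le :: "'a \<Rightarrow> 'a \<Rightarrow> bool" where
  "left_le u v \<longleftrightarrow> (\<forall>z\<in>X. R z < L u \<longrightarrow> R z < L v)"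

definition right_le :: "'a \<Rightarrow> 'a \<Rightarrow> bool" where
  "right_le u v \<longleftrightarrow> (\<forall>z\<in>X. R v < L z \<longrightarrow> R u < L z)"

text \<open>If b \<prec> c or a \<prec> y, then a, b, c, d or a, y, c, d is a chain that forms a 4+1
  with x.\<close>

lemma no_D_star_weak:
  assumes "a \<in> X" "b \<in> X" "c \<in> X" "d \<in> X" "x \<in> X" "y \<in> X"
    and "R a < L b" "L b \<le> R y" "R y < L c" "R b < L d" "R c < L d" "L x \<le> R a" "L d \<le> R x"
  shows False
proof -
  have "L c \<le> R b" "L y \<le> R a"
    using assms no_4_1[of a b c d x] no_4_1[of a y c d x] by (auto simp: not_less[symmetric])
  then show False
    using assms no_D_star[of a b c d x y] by blast
qed

text \<open>An element w before x but not before x' yields a D* with x' and x in the middle; its top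
  is whichever of y and y' starts later.\<close>

lemma inside_same_left_le:
  assumes "x \<in> X" "x' \<in> X" "u \<in> X" "inside x u" "inside x' u"
  shows "left_le x x'"
  unfolding left_le_def
proof (intro ballI impI)
  fix w assume w: "w \<in> X" "R w < L x"
  obtain z y z' y' where zy: "z \<in> X" "y \<in> X" "R z < L x" "R x < L y" "L u \<le> R z" "L y \<le> R u"
    "z' \<in> X" "y' \<in> X" "R z' < L x'" "R x' < L y'" "L u \<le> R z'" "L y' \<le> R u"
    using assms(4,5) unfolding inside_def by blast
  show "R w < L x'"
    using assms(1-3) w zy no_D_star_weak[of z' x' x y u w] no_D_star_weak[of z' x' x y' u w]
    by argo
qed

text \<open>Both u and x lie between z' and y' under v, and z is before x but not before u: a
  D*.\<close>

lemma inside_trans_False: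
  assumes "x \<in> X" "u \<in> X" "v \<in> X" "inside x u" "inside u v"
  shows False
proof -
  obtain z y z' y' where zy: "z \<in> X" "y \<in> X" "R z < L x" "R x < L y" "L u \<le> R z" "L y \<le> R u"
    "z' \<in> X" "y' \<in> X" "R z' < L u" "R u < L y'" "L v \<le> R z'" "L y' \<le> R v"
    using assms(4,5) unfolding inside_def by blast
  then show False
    using assms(1-3) by (intro no_D_star_weak[of z' u x y' v z]) auto
qed

lemma inside_imp_le:
  assumes "inside x u"
  shows "left_le u x" "right_le x u"
  using assms unfolding inside_def left_le_def right_le_def by fastforce+

lemma inside_iff: "inside x u \<longleftrightarrow> \<not> left_le x u \<and> \<not> right_le u x"
  unfolding inside_def left_le_def right_le_def by (auto simp: not_less)

section \<open>Numbering the classes\<close>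

definition preds :: "'a \<Rightarrow> nat" where
  "preds x = card {z \<in> X. R z < L x}"

definition succs :: "'a \<Rightarrow> nat" where
  "succs x = card {z \<in> X. R x < L z}"

text \<open>Both summands grow to the right. For uncontained elements the left and right endpoints
  are ordered alike, so \<open>pos\<close> sorts them and agrees only on twins.\<close>

definition pos :: "'a \<Rightarrow> int" where
  "pos x = int (preds x) - int (succs x)"

text \<open>Predecessor sets form a chain under inclusion, so their sizes determine how they are
  nested.\<close>

lemma left_le_iff: "left_le u v \<longleftrightarrow> preds u \<le> preds v"
proof
  assume "left_le u v"
  then show "preds u \<le> preds v"
    unfolding preds_def left_le_def using fin by (intro card_mono) auto
next
  assume *: "preds u \<le> preds v"
  show "left_le u v"
  proof (rule ccontr)
    assume "\<not> left_le u v"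
    then have "{z \<in> X. R z < L v} \<subset> {z \<in> X. R z < L u}"
      unfolding left_le_def by fastforce
    then have "preds v < preds u"
      unfolding preds_def using fin by (intro psubset_card_mono) auto
    with * show False by simp
  qed
qed

lemma right_le_iff: "right_le u v \<longleftrightarrow> succs v \<le> succs u"
proof
  assume "right_le u v"
  then show "succs v \<le> succs u"
    unfolding succs_def right_le_def using fin by (intro card_mono) auto
next
  assume *: "succs v \<le> succs u"
  show "right_le u v"
  proof (rule ccontr)
    assume "\<not> right_le u v"
    then have "{z \<in> X. R u < L z} \<subset> {z \<in> X. R v < L z}"
      unfolding right_le_def by fastforce
    then have "succs u < succs v"
      unfolding succs_def using fin by (intro psubset_card_mono) auto
    with * show False by simp
  qed
qed

definition uncontained :: "'a \<Rightarrow> bool" where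
  "uncontained x \<longleftrightarrow> \<not> (\<exists>u\<in>X. inside x u)"

text \<open>The representative of the class of \<open>x\<close>. By
  \<open>inside_trans_False\<close> the chosen \<open>u\<close> is itself uncontained.\<close>

definition container :: "'a \<Rightarrow> 'a" where
  "container x = (if uncontained x then x else SOME u. u \<in> X \<and> inside x u)"

definition idx :: "'a \<Rightarrow> int" where
  "idx x = pos (container x)"

lemma container_cases:
  assumes "x \<in> X"
  shows "container x = x \<and> uncontained x \<or> container x \<in> X \<and> inside x (container x)"
  unfolding container_def uncontained_def using someI_ex[of "\<lambda>u. u \<in> X \<and> inside x u"] by auto

lemma container_in: "x \<in> X \<Longrightarrow> container x \<in> X"
  using container_cases by metis

lemma uncontained_container: "x \<in> X \<Longrightarrow> uncontained (container x)"
  using container_cases inside_trans_False unfolding uncontained_def by metis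

lemma idx_container: "x \<in> X \<Longrightarrow> idx (container x) = idx x"
  using uncontained_container unfolding idx_def container_def[of "container x"] by simp

lemma container_le:
  assumes "x \<in> X"
  shows "left_le (container x) x" "right_le x (container x)"
  using container_cases[OF assms] inside_imp_le by (auto simp: left_le_iff right_le_iff)

text \<open>If one endpoint were ordered the wrong way, \<open>pos a \<le> pos b\<close> would force
  the other to differ strictly the right way, and one element would be inside the other.\<close>

lemma pos_le_imp:
  assumes "a \<in> X" "b \<in> X" "uncontained a" "uncontained b" "pos a \<le> pos b"
  shows "left_le a b" "right_le a b"
  using assms unfolding uncontained_def inside_iff left_le_iff right_le_iff pos_def by force+

end

text \<open>The reflection \<open>L \<mapsto> - R\<close>, \<open>R \<mapsto> - L\<close> represents the dual order, so this locale is
  closed under duality.\<close>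
locale forbidden_free = forbidden_free_half X L R +
    dual: forbidden_free_half X "\<lambda>x. - R x" "\<lambda>x. - L x"
  for X :: "'a set" and L R :: "'a \<Rightarrow> real"
begin

lemma forbidden_free_dual: "forbidden_free X (\<lambda>x. - R x) (\<lambda>x. - L x)"
proof -
  have "forbidden_free_half X (\<lambda>x. - R x) (\<lambda>x. - L x)"
    "forbidden_free_half X (\<lambda>x. - (- L x)) (\<lambda>x. - (- R x))"
    unfolding minus_minus by unfold_locales
  then show ?thesis
    unfolding forbidden_free_def by blast
qed

lemma dual_inside: "dual.inside x u \<longleftrightarrow> inside x u"
  unfolding inside_def dual.inside_def by auto

lemma dual_left_le: "dual.left_le u v \<longleftrightarrow> right_le v u"
  unfolding right_le_def dual.left_le_def by auto

text \<open>Suppose b overlaps xa, and consider z \<prec> xa \<prec> xb \<prec> y'. Excluding 4+1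
  gives z \<prec> b and a \<prec> y', and then excluding Z gives a \<prec> xb. Now y overlaps both a
  and xb, which yields D* if y \<prec> y' and the dual of Y** otherwise.\<close>

lemma inside_less_left:
  assumes X: "xa \<in> X" "a \<in> X" "xb \<in> X" "b \<in> X"
    and "inside xa a" "inside xb b" "R xa < L xb"
  shows "R xa < L b"
proof (rule ccontr)
  assume neg: "\<not> R xa < L b"
  obtain z y where zy: "z \<in> X" "y \<in> X" "R z < L xa" "R xa < L y" "L a \<le> R z" "L y \<le> R a"
    using assms(5) unfolding inside_def by blast
  obtain z' y' where zy': "z' \<in> X" "y' \<in> X" "R z' < L xb" "R xb < L y'" "L b \<le> R z'" "L y' \<le> R b"
    using assms(6) unfolding inside_def by blast
  note le = LR[OF X(1)] LR[OF X(2)] LR[OF X(3)] LR[OF X(4)] LR[OF zy(1)] LR[OF zy(2)] LR[OF zy'(2)]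
  have zb: "R z < L b"
    using no_4_1[of z xa xb y' b] X zy zy' neg assms(7) le by argo
  have ay': "R a < L y'"
    using no_4_1[of z xa xb y' a] X zy zy' neg assms(7) le by argo
  have axb: "R a < L xb"
    using no_Z[of z xa xb y' a b] X zy zy' neg assms(7) le zb ay' by argo
  have "R xb \<ge> L y" using axb zy le by argo
  moreover have "L xb \<le> R y"
    using no_4_1[of xa y xb y' b] X zy zy' neg assms(7) by argo
  ultimately show False
    using no_D_star[of xa y xb y' b a] dual.no_Y_star_star[of y' a xa xb b y] X zy zy' neg assms(7) le axb
    by argo
qed

lemma dual_pos: "dual.pos x = - pos x"
  unfolding pos_def dual.pos_def preds_def succs_def dual.preds_def dual.succs_def by simp

lemma dual_uncontained: "dual.uncontained x \<longleftrightarrow> uncontained x"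
  unfolding uncontained_def dual.uncontained_def by (simp add: dual_inside)

lemma dual_container: "dual.container x = container x"
  unfolding container_def dual.container_def by (simp add: dual_inside dual_uncontained)

lemma dual_idx: "dual.idx x = - idx x"
  unfolding idx_def dual.idx_def by (simp add: dual_pos dual_container)

lemma inside_same_right_le:
  assumes "x \<in> X" "x' \<in> X" "u \<in> X" "inside x u" "inside x' u"
  shows "right_le x x'"
  using dual.inside_same_left_le[of x' x u] assms by (simp add: dual_inside dual_left_le)

text \<open>Suppose b overlaps a'. A witness w that a' starts strictly earlier gives the dual of Y*.
  A witness w that a' ends strictly earlier gives D* or the dual of Y**, according to whether w
  \<prec> y'. The remaining overlaps come from excluding 4+1.\<close>

lemma lower_than_less_inside:
  assumes X: "a \<in> X" "a' \<in> X" "y \<in> X" "b \<in> X"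
    and le: "left_le a' a" "right_le a' a" and strict: "\<not> left_le a a' \<or> \<not> right_le a a'"
    and "inside y b" "R a < L y"
  shows "R a' < L b"
proof (rule ccontr)
  assume neg: "\<not> R a' < L b"
  obtain y' where y': "y' \<in> X" "R y < L y'" "L y' \<le> R b"
    using assms(8) unfolding inside_def by blast
  have a'y: "R a' < L y" and ab: "L b \<le> R a"
    using le assms(9) X neg unfolding right_le_def by (auto simp: not_less[symmetric])
  note lr = LR[OF X(1)] LR[OF X(2)] LR[OF X(3)] LR[OF X(4)] LR[OF y'(1)]
  have a'a: "L a \<le> R a'"
    using no_4_1[of a' a y y' b] X y' neg assms(9) by argo
  from strict show False
  proof
    assume "\<not> left_le a a'"
    then obtain w where w: "w \<in> X" "R w < L a" "L a' \<le> R w"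
      unfolding left_le_def by (auto simp: not_less)
    have "R w < L b"
      using no_4_1[of w a y y' b] w X y' assms(9) by argo
    then show False
      using dual.no_Y_star[of y' a' w y a b] X w y' a'y ab a'a neg assms(9) lr LR[OF w(1)]
      by argo
  next
    assume "\<not> right_le a a'"
    then obtain w where w: "w \<in> X" "R a' < L w" "L w \<le> R a"
      unfolding right_le_def by (auto simp: not_less)
    have "L y \<le> R w"
      using no_4_1[of a' w y y' b] w X y' neg by argo
    then show False
      using no_D_star[of a' w y y' b a] dual.no_Y_star_star[of y' a a' y b w]
        X w y' a'y ab a'a neg assms(9) lr LR[OF w(1)]
      by argo
  qed
qed

text \<open>If b overlaps a', a witness w for the strictly earlier left endpoint gives 4+1 when w
  \<prec> z and the dual of Y** otherwise; one for the right endpoint gives 4+1 when b \<prec> w and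
  Y** otherwise.\<close>

lemma lower_than_container_less:
  assumes X: "a \<in> X" "a' \<in> X" "x \<in> X" "b \<in> X"
    and le: "left_le a' a" "right_le a' a" and strict: "\<not> left_le a a' \<or> \<not> right_le a a'"
    and "inside x a" "R x < L b"
  shows "R a' < L b"
proof (rule ccontr)
  assume neg: "\<not> R a' < L b"
  obtain z where z: "z \<in> X" "R z < L x" "L a \<le> R z"
    using assms(8) unfolding inside_def by blast
  have a'z: "L a' \<le> R z" and ab: "L b \<le> R a"
    using le X neg z unfolding right_le_def left_le_def by (auto simp: not_less[symmetric])
  note lr = LR[OF X(1)] LR[OF X(2)] LR[OF X(3)] LR[OF X(4)] LR[OF z(1)]
  from strict show False
  proof
    assume "\<not> left_le a a'"
    then obtain w where w: "w \<in> X" "R w < L a" "L a' \<le> R w"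
      unfolding left_le_def by (auto simp: not_less)
    then show False
      using no_4_1[of w z x b a'] dual.no_Y_star_star[of b z w x a' a]
        X z a'z ab neg assms(9) lr LR[OF w(1)]
      by argo
  next
    assume "\<not> right_le a a'"
    then obtain w where w: "w \<in> X" "R a' < L w" "L w \<le> R a"
      unfolding right_le_def by (auto simp: not_less)
    then show False
      using no_4_1[of z x b w a] no_Y_star_star[of z b w x a a']
        X z a'z ab neg assms(9) lr LR[OF w(1)]
      by argo
  qed
qed

section \<open>Comparabilities between classes\<close>

lemma less_container_left:
  assumes X: "x \<in> X" "y \<in> X" and "R x < L y" and "inside x (container x)"
  shows "R x < L (container y)"
  using container_cases[OF X(2)] inside_less_left[of x "container x" y "container y"]
    container_in[OF X(1)] assms by auto

text \<open>This is the monotonicity behind the greedy choice: one comparability between two classes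
  makes even the closed members comparable once the lower class is replaced by a strictly lower
  one.\<close>

lemma lower_class_less:
  assumes X: "x \<in> X" "y \<in> X" and "R x < L y" and a': "a' \<in> X" "uncontained a'" "pos a' < idx x"
  shows "R a' < L (container y)"
proof -
  note cX = container_in[OF X(1)] container_in[OF X(2)]
  have le: "left_le a' (container x)" "right_le a' (container x)"
    using pos_le_imp[of a' "container x"] uncontained_container[OF X(1)] a' cX
    by (auto simp: idx_def)
  have strict: "\<not> left_le (container x) a' \<or> \<not> right_le (container x) a'"
    using a'(3) unfolding idx_def pos_def left_le_iff right_le_iff by linarith
  show ?thesis
  proof (cases "inside x (container x)")
    case True
    then show ?thesis
      using lower_than_container_less[OF cX(1) a'(1) X(1) cX(2) le strict True]
        less_container_left[OF X assms(3)] by blast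
  next
    case False
    then have x: "container x = x"
      using container_cases[OF X(1)] by blast
    show ?thesis
    proof (cases "inside y (container y)")
      case True
      then show ?thesis
        using lower_than_less_inside[OF cX(1) a'(1) X(2) cX(2) le strict True] assms(3) x by simp
    next
      case False
      then have "container y = y"
        using container_cases[OF X(2)] by blast
      then show ?thesis
        using le(2) assms(3) X x unfolding right_le_def by simp
    qed
  qed
qed

lemma upper_class_less:
  assumes X: "x \<in> X" "y \<in> X" and "R x < L y" and b': "b' \<in> X" "uncontained b'" "idx y < pos b'"
  shows "R (container x) < L b'"
proof -
  interpret d: forbidden_free X "\<lambda>x. - R x" "\<lambda>x. - L x"
    by (rule forbidden_free_dual)
  show ?thesis
    using d.lower_class_less[of y x b'] assms
    by (simp add: dual_container dual_pos dual_idx dual_uncontained)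
qed

text \<open>If the class of y came first, \<open>lower_class_less\<close> would put
  \<open>container y\<close> before itself. In a common class the containers are twins; a member
  comparable to such a twin would be comparable to itself, and two members inside it are twins of
  each other.\<close>

lemma less_imp_idx_less:
  assumes X: "x \<in> X" "y \<in> X" and "R x < L y"
  shows "idx x < idx y"
proof (rule ccontr)
  assume neg: "\<not> idx x < idx y"
  note cX = container_in[OF X(1)] container_in[OF X(2)]
  note u = uncontained_container[OF X(1)] uncontained_container[OF X(2)]
  have ge: "idx x = idx y"
    using lower_class_less[OF assms cX(2) u(2)] LR[OF cX(2)] neg by (force simp: idx_def)
  then have tw: "left_le (container x) (container y)" "right_le (container x) (container y)"
    "left_le (container y) (container x)" "right_le (container y) (container x)"
    using pos_le_imp[OF cX u] pos_le_imp[OF cX(2,1) u(2,1)] by (auto simp: idx_def)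
  consider "container x = x" | "inside x (container x)" "container y = y"
    | "inside x (container x)" "inside y (container y)"
    using container_cases X by blast
  then show False
  proof cases
    case 1
    then have "R (container y) < L y"
      using tw(4) X assms(3) unfolding right_le_def by simp
    then have "R y < L y"
      using container_le(2)[OF X(2)] X(2) unfolding right_le_def by blast
    then show False using LR[OF X(2)] by simp
  next
    case 2
    then have "R x < L (container x)"
      using tw(3) X assms(3) unfolding left_le_def by simp
    then have "R x < L x"
      using container_le(1)[OF X(1)] X(1) unfolding left_le_def by blast
    then show False using LR[OF X(1)] by simp
  next
    case 3
    have "inside y (container x)"
      using 3(2) tw unfolding inside_iff left_le_iff right_le_iff by linarith
    then have "left_le y x"
      using inside_same_left_le[OF X(2,1) cX(1)] 3(1) by blast
    then show False
      using assms(3) X LR[OF X(1)] unfolding left_le_def by fastforce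
  qed
qed

text \<open>The target is \<open>R x' < L (container y)\<close>, which suffices for every y' of the
  class. If x is inside its container, x' is its twin; otherwise x' is inside x, so x' \<prec> y,
  and \<open>inside_less_left\<close> passes to the container.\<close>

lemma same_idx_less_inside:
  assumes X: "x \<in> X" "y \<in> X" "x' \<in> X" "y' \<in> X" and "R x < L y"
    and "idx x' = idx x" "idx y' = idx y" "\<not> uncontained x'"
  shows "R x' < L y'"
proof -
  note cX = container_in[OF X(1)] container_in[OF X(2)] container_in[OF X(3)] container_in[OF X(4)]
  note u = uncontained_container[OF X(1)] uncontained_container[OF X(2)]
    uncontained_container[OF X(3)] uncontained_container[OF X(4)]
  have tx: "left_le (container x) (container x')" "right_le (container x') (container x)"
      "left_le (container x') (container x)" "right_le (container x) (container x')"
    using pos_le_imp[OF cX(1,3) u(1,3)] pos_le_imp[OF cX(3,1) u(3,1)] assms(6)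
    by (auto simp: idx_def)
  have ty: "left_le (container y) (container y')"
    using pos_le_imp[OF cX(2,4) u(2,4)] assms(7) by (auto simp: idx_def)
  have "inside x' (container x')"
    using container_cases[OF X(3)] assms(8) by auto
  then have ins: "inside x' (container x)"
    using tx unfolding inside_iff left_le_iff right_le_iff by linarith
  have "R x' < L (container y)"
  proof (cases "inside x (container x)")
    case True
    then show ?thesis
      using less_container_left[OF X(1,2) assms(5)] inside_same_right_le[OF X(3,1) cX(1) ins]
        cX(2) unfolding right_le_def by blast
  next
    case False
    then have "container x = x"
      using container_cases[OF X(1)] by blast
    then have "R x' < L y"
      using inside_imp_le(2)[OF ins] assms(5) X unfolding right_le_def by simp
    then show ?thesis
      using container_cases[OF X(2)] inside_less_left[OF X(3) cX(1) X(2) cX(2) ins] by auto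
  qed
  then show ?thesis
    using ty container_le(1)[OF X(4)] X(3) unfolding left_le_def by blast
qed

lemma same_idx_less:
  assumes X: "x \<in> X" "y \<in> X" "x' \<in> X" "y' \<in> X" and "R x < L y"
    and "idx x' = idx x" "idx y' = idx y" "\<not> (uncontained x' \<and> uncontained y')"
  shows "R x' < L y'"
proof (cases "uncontained x'")
  case True
  interpret d: forbidden_free X "\<lambda>x. - R x" "\<lambda>x. - L x"
    by (rule forbidden_free_dual)
  show ?thesis
    using d.same_idx_less_inside[of y x y' x'] assms True
    by (simp add: dual_idx dual_uncontained)
qed (use assms same_idx_less_inside in blast)

lemma same_idx_less_uncontained:
  assumes X: "x \<in> X" "y \<in> X" "x' \<in> X" "y' \<in> X" and "R x < L y"
    and "idx x' = idx x" "idx y' = idx y" "uncontained x" "uncontained y"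
  shows "R x' < L y'"
proof -
  have c: "container x = x" "container y = y"
    using assms unfolding container_def by auto
  have "right_le (container x') x" "left_le y (container y')"
    using pos_le_imp[of "container x'" x] pos_le_imp[of y "container y'"] X c assms(6-9)
      container_in uncontained_container by (auto simp: idx_def)
  then show ?thesis
    using assms(5) X container_le(2)[OF X(3)] container_le(1)[OF X(4)]
    unfolding left_le_def right_le_def by blast
qed

end

section \<open>From excluded induced posets to the inequalities of the locale\<close>

lemma forbidden_free_halfI:
  fixes L R :: "'a \<Rightarrow> real"
  assumes "finite X" and LR: "\<And>x. x \<in> X \<Longrightarrow> L x \<le> R x"
    and lt: "\<And>x y. x \<in> X \<Longrightarrow> y \<in> X \<Longrightarrow> lt x y \<longleftrightarrow> R x < L y"
    and free: "\<forall>Q\<in>{four_plus_one, D_star, Z_poset, Y_star, Y_star_star}. \<not> contains_induced X lt Q"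
  shows "forbidden_free_half X L R"
proof
  fix a b c d x
  assume h: "a \<in> X" "b \<in> X" "c \<in> X" "d \<in> X" "x \<in> X" "R a < L b" "R b < L c" "R c < L d"
    "L x \<le> R a" "L d \<le> R x"
  note lr = LR[OF h(1)] LR[OF h(2)] LR[OF h(3)] LR[OF h(4)] LR[OF h(5)]
  have "contains_induced X lt four_plus_one" (is "contains_induced X lt ?Q")
  proof (rule contains_induced_listI)
    let ?xs = "[a, b, c, d, x]"
    show "distinct ?xs" using h lr by auto
    show "\<forall>u<fst ?Q. \<forall>v<fst ?Q. (u, v) \<in> (set (snd ?Q))\<^sup>+ \<longleftrightarrow> lt (?xs ! u) (?xs ! v)"
      unfolding fst_forbidden trancl_forbidden all_less_5_6 using h lr by (simp add: lt)
  qed (use h in \<open>simp_all add: fst_forbidden\<close>)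
  then show False using free by blast
next
  fix a b c d x y
  assume h: "a \<in> X" "b \<in> X" "c \<in> X" "d \<in> X" "x \<in> X" "y \<in> X" "R a < L b" "L b \<le> R y" "R y < L c"
    "L c \<le> R b" "R b < L d" "R c < L d" "L y \<le> R a" "L x \<le> R a" "L d \<le> R x"
  note lr = LR[OF h(1)] LR[OF h(2)] LR[OF h(3)] LR[OF h(4)] LR[OF h(5)] LR[OF h(6)]
  have "contains_induced X lt D_star" (is "contains_induced X lt ?Q")
  proof (rule contains_induced_listI)
    let ?xs = "[a, b, c, d, x, y]"
    show "distinct ?xs" using h lr by auto
    show "\<forall>u<fst ?Q. \<forall>v<fst ?Q. (u, v) \<in> (set (snd ?Q))\<^sup>+ \<longleftrightarrow> lt (?xs ! u) (?xs ! v)"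
      unfolding fst_forbidden trancl_forbidden all_less_5_6 using h lr by (simp add: lt)
  qed (use h in \<open>simp_all add: fst_forbidden\<close>)
  then show False using free by blast
next
  fix a b c d x y
  assume h: "a \<in> X" "b \<in> X" "c \<in> X" "d \<in> X" "x \<in> X" "y \<in> X" "R a < L b" "R b < L c" "R c < L d"
    "R x < L d" "L c \<le> R x" "L x \<le> R a" "R a < L y" "L y \<le> R b" "L d \<le> R y"
  note lr = LR[OF h(1)] LR[OF h(2)] LR[OF h(3)] LR[OF h(4)] LR[OF h(5)] LR[OF h(6)]
  have "contains_induced X lt Z_poset" (is "contains_induced X lt ?Q")
  proof (rule contains_induced_listI)
    let ?xs = "[a, b, c, d, x, y]"
    show "distinct ?xs" using h lr by auto
    show "\<forall>u<fst ?Q. \<forall>v<fst ?Q. (u, v) \<in> (set (snd ?Q))\<^sup>+ \<longleftrightarrow> lt (?xs ! u) (?xs ! v)"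
      unfolding fst_forbidden trancl_forbidden all_less_5_6 using h lr by (simp add: lt)
  qed (use h in \<open>simp_all add: fst_forbidden\<close>)
  then show False using free by blast
next
  fix a b c d p q
  assume h: "a \<in> X" "b \<in> X" "c \<in> X" "d \<in> X" "p \<in> X" "q \<in> X" "R a < L d" "R d < L p" "R p < L c"
    "R q < L c" "L p \<le> R q" "L q \<le> R a" "R d < L b" "L b \<le> R p" "L c \<le> R b" "L b \<le> R q"
  note lr = LR[OF h(1)] LR[OF h(2)] LR[OF h(3)] LR[OF h(4)] LR[OF h(5)] LR[OF h(6)]
  have "contains_induced X lt Y_star" (is "contains_induced X lt ?Q")
  proof (rule contains_induced_listI)
    let ?xs = "[a, d, p, c, q, b]"
    show "distinct ?xs" using h lr by auto
    show "\<forall>u<fst ?Q. \<forall>v<fst ?Q. (u, v) \<in> (set (snd ?Q))\<^sup>+ \<longleftrightarrow> lt (?xs ! u) (?xs ! v)"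
      unfolding fst_forbidden trancl_forbidden all_less_5_6 using h lr by (simp add: lt)
  qed (use h in \<open>simp_all add: fst_forbidden\<close>)
  then show False using free by blast
next
  fix a b c d x y
  assume h: "a \<in> X" "b \<in> X" "c \<in> X" "d \<in> X" "x \<in> X" "y \<in> X" "R a < L d" "R d < L b" "R d < L c"
    "R y < L c" "L b \<le> R y" "L c \<le> R b" "L y \<le> R a" "L x \<le> R a" "L b \<le> R x" "L c \<le> R x"
  note lr = LR[OF h(1)] LR[OF h(2)] LR[OF h(3)] LR[OF h(4)] LR[OF h(5)] LR[OF h(6)]
  have "contains_induced X lt Y_star_star" (is "contains_induced X lt ?Q")
  proof (rule contains_induced_listI)
    let ?xs = "[a, b, c, d, x, y]"
    show "distinct ?xs" using h lr by auto
    show "\<forall>u<fst ?Q. \<forall>v<fst ?Q. (u, v) \<in> (set (snd ?Q))\<^sup>+ \<longleftrightarrow> lt (?xs ! u) (?xs ! v)"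
      unfolding fst_forbidden trancl_forbidden all_less_5_6 using h lr by (simp add: lt)
  qed (use h in \<open>simp_all add: fst_forbidden\<close>)
  then show False using free by blast
qed (use assms in auto)

section \<open>Greedy choice of the left endpoints\<close>

lemma real_between_finite_sets:
  fixes A B :: "real set"
  assumes "finite A" "finite B" "\<And>a b. a \<in> A \<Longrightarrow> b \<in> B \<Longrightarrow> a < b"
  shows "\<exists>v. (\<forall>a\<in>A. a < v) \<and> (\<forall>b\<in>B. v < b)"
proof (cases "A = {} \<or> B = {}")
  case True
  obtain u v where uv: "\<forall>a\<in>A. a \<le> u" "\<forall>b\<in>B. v \<le> b"
    using assms(1,2) by (metis Max_ge Min_le)
  from True show ?thesis
  proof
    assume "A = {}"
    then show ?thesis using uv(2) by (intro exI[of _ "v - 1"]) force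
  next
    assume "B = {}"
    then show ?thesis using uv(1) by (intro exI[of _ "u + 1"]) force
  qed
next
  case False
  then have "Max A < Min B"
    using assms by simp
  then obtain v where "Max A < v" "v < Min B"
    using dense by blast
  then show ?thesis
    using assms False by auto
qed

text \<open>\<open>gt\<close> and \<open>ge\<close> prescribe distance > 1 and \<ge> 1, so
  \<open>ge\<close> without \<open>gt\<close> prescribes exactly 1. The induction places the largest
  index b to the right of all others.\<close>

lemma greedy_positions:
  fixes I :: "'i :: linorder set" and gt ge :: "'i \<Rightarrow> 'i \<Rightarrow> bool"
  assumes "finite I"
    and gt_ge: "\<And>i j. i \<in> I \<Longrightarrow> j \<in> I \<Longrightarrow> gt i j \<Longrightarrow> ge i j"
    and ge_less: "\<And>i j. i \<in> I \<Longrightarrow> j \<in> I \<Longrightarrow> ge i j \<Longrightarrow> i < j"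
    and ge_gt: "\<And>i j i' j'. \<lbrakk>i \<in> I; j \<in> I; i' \<in> I; j' \<in> I; ge i j; i' \<le> i; j \<le> j'; i' < i \<or> j < j'\<rbrakk>
      \<Longrightarrow> gt i' j'"
  shows "\<exists>l :: 'i \<Rightarrow> real. (\<forall>i\<in>I. \<forall>j\<in>I. i < j \<longrightarrow> l i < l j) \<and>
    (\<forall>i\<in>I. \<forall>j\<in>I. (gt i j \<longleftrightarrow> l i + 1 < l j) \<and> (ge i j \<longleftrightarrow> l i + 1 \<le> l j))"
  using assms
proof (induction I rule: finite_linorder_max_induct)
  case empty
  then show ?case by simp
next
  case (insert b A)
  note gt_ge = insert.prems(1) and ge_less = insert.prems(2) and ge_gt = insert.prems(3)
  have "\<exists>l :: 'i \<Rightarrow> real. (\<forall>i\<in>A. \<forall>j\<in>A. i < j \<longrightarrow> l i < l j) \<and>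
    (\<forall>i\<in>A. \<forall>j\<in>A. (gt i j \<longleftrightarrow> l i + 1 < l j) \<and> (ge i j \<longleftrightarrow> l i + 1 \<le> l j))"
  proof (rule insert.IH)
    show "gt i' j'" if "i \<in> A" "j \<in> A" "i' \<in> A" "j' \<in> A" "ge i j" "i' \<le> i" "j \<le> j'" "i' < i \<or> j < j'"
      for i j i' j'
      using ge_gt[of i j i' j'] that by blast
  qed (use gt_ge ge_less in blast)+
  then obtain l :: "'i \<Rightarrow> real"
    where mono: "\<And>i j. i \<in> A \<Longrightarrow> j \<in> A \<Longrightarrow> i < j \<Longrightarrow> l i < l j"
      and l: "\<And>i j. i \<in> A \<Longrightarrow> j \<in> A \<Longrightarrow> gt i j \<longleftrightarrow> l i + 1 < l j"
        "\<And>i j. i \<in> A \<Longrightarrow> j \<in> A \<Longrightarrow> ge i j \<longleftrightarrow> l i + 1 \<le> l j"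
    by blast
  have below: "a < b" if "a \<in> A" for a
    using insert.hyps that by blast
  have "\<exists>v. (\<forall>a\<in>A. l a < v) \<and> (\<forall>a\<in>A. (gt a b \<longleftrightarrow> l a + 1 < v) \<and> (ge a b \<longleftrightarrow> l a + 1 \<le> v))"
  proof (cases "\<exists>t\<in>A. ge t b \<and> \<not> gt t b")
    \<comment> \<open>Such a \<open>t\<close> must be at distance exactly 1 from \<open>b\<close>, which determines \<open>l b\<close>.\<close>
    case True
    then obtain t where t: "t \<in> A" "ge t b" "\<not> gt t b"
      by blast
    \<comment> \<open>Otherwise \<open>ge t a\<close>, and since a < b monotonicity would give
      \<open>gt t b\<close>.\<close>
    have "l a < l t + 1" if "a \<in> A" for a
      using ge_gt[of t a t b] t that below[OF that] l(2)[of t a] by force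
    moreover have "(gt a b \<longleftrightarrow> l a + 1 < l t + 1) \<and> (ge a b \<longleftrightarrow> l a + 1 \<le> l t + 1)"
      if a: "a \<in> A" for a
    proof -
      consider "a < t" | "a = t" | "t < a" by fastforce
      then show ?thesis
      proof cases
        case 1
        then show ?thesis
          using mono[OF a t(1)] ge_gt[of t b a b] gt_ge[of a b] t a by auto
      next
        case 2
        then show ?thesis using t by simp
      next
        case 3
        then have "\<not> ge a b"
          using ge_gt[of a b t b] t a less_imp_le[OF 3] by auto
        then show ?thesis
          using mono[OF t(1) a 3] gt_ge[of a b] a by auto
      qed
    qed
    ultimately show ?thesis by blast
  next
    case False
    \<comment> \<open>No distance to b is exactly 1: those in \<open>P\<close> must be more than 1
      away, those in \<open>S\<close> less than 1. As monotonicity puts \<open>P\<close> below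
      \<open>S\<close>, a gap for \<open>v\<close> remains.\<close>
    define P where "P = {a \<in> A. ge a b}"
    define S where "S = {a \<in> A. \<not> ge a b}"
    have "\<exists>v. (\<forall>u\<in>(\<lambda>a. l a + 1) ` P \<union> l ` A. u < v) \<and> (\<forall>w\<in>(\<lambda>a. l a + 1) ` S. v < w)"
    proof (rule real_between_finite_sets)
      fix u w assume u: "u \<in> (\<lambda>a. l a + 1) ` P \<union> l ` A" and w: "w \<in> (\<lambda>a. l a + 1) ` S"
      obtain s where s: "s \<in> A" "\<not> ge s b" "w = l s + 1"
        using w unfolding S_def by blast
      have "l a < l s + 1" if "a \<in> A" for a
        using ge_gt[of s a s b] gt_ge[of s b] s that below[OF that] l(2)[of s a] by force
      moreover have "l p < l s" if "p \<in> A" "ge p b" for p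
        using ge_gt[of p b s b] gt_ge[of s b] s that mono[of p s] by force
      ultimately show "u < w"
        using u s(3) unfolding P_def by auto
    qed (use insert.hyps in \<open>auto simp: P_def S_def\<close>)
    then obtain v where v: "\<forall>a\<in>P. l a + 1 < v" "\<forall>a\<in>A. l a < v" "\<forall>a\<in>S. v < l a + 1"
      by (auto simp: ball_Un)
    have "(gt a b \<longleftrightarrow> l a + 1 < v) \<and> (ge a b \<longleftrightarrow> l a + 1 \<le> v)" if a: "a \<in> A" for a
    proof (cases "ge a b")
      case True
      then have "gt a b" "l a + 1 < v"
        using False v(1) a unfolding P_def by blast+
      with True show ?thesis by simp
    next
      case not_ge: False
      then have "\<not> gt a b" "v < l a + 1"
        using gt_ge[of a b] v(3) a unfolding S_def by blast+
      with not_ge show ?thesis by simp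
    qed
    with v(2) show ?thesis by blast
  qed
  then obtain v where v: "\<And>a. a \<in> A \<Longrightarrow> l a < v"
      "\<And>a. a \<in> A \<Longrightarrow> gt a b \<longleftrightarrow> l a + 1 < v" "\<And>a. a \<in> A \<Longrightarrow> ge a b \<longleftrightarrow> l a + 1 \<le> v"
    by blast
  have top: "\<not> ge b i \<and> \<not> gt b i" if "i \<in> insert b A" for i
    using ge_less[of b i] gt_ge[of b i] that below by fastforce
  have "b \<notin> A" using below by blast
  define l' where "l' = l(b := v)"
  have l'b: "l' b = v" and l'A: "\<And>a. a \<in> A \<Longrightarrow> l' a = l a"
    using \<open>b \<notin> A\<close> by (auto simp: l'_def)
  have "l' i < l' j" if "i \<in> insert b A" "j \<in> insert b A" "i < j" for i j
    using that below[of j] mono v(1) l'b l'A by auto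
  moreover have "(gt i j \<longleftrightarrow> l' i + 1 < l' j) \<and> (ge i j \<longleftrightarrow> l' i + 1 \<le> l' j)"
    if ij: "i \<in> insert b A" "j \<in> insert b A" for i j
  proof (cases "i = b")
    case True
    then show ?thesis
      using top[OF ij(2)] ij v(1)[of j] l'b l'A[of j] by auto
  next
    case False
    then show ?thesis
      using ij l v l'b l'A by auto
  qed
  ultimately show ?case by blast
qed

lemma (in forbidden_free) unit_rep_exists: "\<exists>l. unit_rep X (\<lambda>x y. R x < L y) l uncontained"
proof -
  \<comment> \<open>All members of a class share one left endpoint. Two closed intervals are
    comparable only at distance > 1, every other pair already at distance 1; \<open>gt\<close> and
    \<open>ge\<close> record these demands.\<close>
  define gt where "gt i j \<longleftrightarrow> (\<exists>x\<in>X. \<exists>y\<in>X. uncontained x \<and> uncontained y \<and> idx x = i \<and> idx y = j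
    \<and> R x < L y)" for i j
  define ge where "ge i j \<longleftrightarrow> (\<exists>x\<in>X. \<exists>y\<in>X. idx x = i \<and> idx y = j \<and> R x < L y)" for i j
  have "\<exists>l :: int \<Rightarrow> real. (\<forall>i\<in>idx ` X. \<forall>j\<in>idx ` X. i < j \<longrightarrow> l i < l j) \<and>
    (\<forall>i\<in>idx ` X. \<forall>j\<in>idx ` X. (gt i j \<longleftrightarrow> l i + 1 < l j) \<and> (ge i j \<longleftrightarrow> l i + 1 \<le> l j))"
  proof (rule greedy_positions)
    show "finite (idx ` X)" using fin by simp
    show "ge i j" if "gt i j" for i j
      using that unfolding gt_def ge_def by blast
    show "i < j" if "ge i j" for i j
      using that less_imp_idx_less unfolding ge_def by blast
    show "gt i' j'" if "i' \<in> idx ` X" "j' \<in> idx ` X" "ge i j" and le: "i' \<le> i" "j \<le> j'"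
      and strict: "i' < i \<or> j < j'" for i j i' j'
    proof -
      obtain x y where xy: "x \<in> X" "y \<in> X" "idx x = i" "idx y = j" "R x < L y"
        using \<open>ge i j\<close> unfolding ge_def by blast
      obtain u v where uv: "u \<in> X" "v \<in> X" "idx u = i'" "idx v = j'"
        using \<open>i' \<in> idx ` X\<close> \<open>j' \<in> idx ` X\<close> by blast
      note cX = container_in[OF xy(1)] container_in[OF xy(2)] container_in[OF uv(1)] container_in[OF uv(2)]
      note un = uncontained_container[OF xy(1)] uncontained_container[OF xy(2)]
        uncontained_container[OF uv(1)] uncontained_container[OF uv(2)]
      have ux: "right_le (container u) (container x)"
        using pos_le_imp[OF cX(3,1) un(3,1)] le xy uv by (simp add: idx_def)
      have yv: "left_le (container y) (container v)"
        using pos_le_imp[OF cX(2,4) un(2,4)] le xy uv by (simp add: idx_def)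
      \<comment> \<open>The class that moves strictly outwards supplies the comparability between
        containers; the other class moves weakly and preserves it.\<close>
      have "R (container u) < L (container v)"
        using strict
      proof
        assume "i' < i"
        then have "R (container u) < L (container y)"
          using lower_class_less[OF xy(1,2,5) cX(3) un(3)] xy uv by (simp add: idx_def)
        then show ?thesis using yv cX(3) unfolding left_le_def by blast
      next
        assume "j < j'"
        then have "R (container x) < L (container v)"
          using upper_class_less[OF xy(1,2,5) cX(4) un(4)] xy uv by (simp add: idx_def)
        then show ?thesis using ux cX(4) unfolding right_le_def by blast
      qed
      then show ?thesis
        unfolding gt_def using cX un uv idx_container by blast
    qed
  qed
  then obtain l :: "int \<Rightarrow> real" where "\<forall>i\<in>idx ` X. \<forall>j\<in>idx ` X.
      (gt i j \<longleftrightarrow> l i + 1 < l j) \<and> (ge i j \<longleftrightarrow> l i + 1 \<le> l j)"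
    by (elim exE conjE)
  then have l: "gt (idx x) (idx y) \<longleftrightarrow> l (idx x) + 1 < l (idx y)"
    "ge (idx x) (idx y) \<longleftrightarrow> l (idx x) + 1 \<le> l (idx y)" if "x \<in> X" "y \<in> X" for x y
    using that by simp_all
  have "unit_rep X (\<lambda>x y. R x < L y) (\<lambda>x. l (idx x)) uncontained"
    unfolding unit_rep_def
  proof (intro ballI)
    fix x y assume X: "x \<in> X" "y \<in> X"
    show "R x < L y \<longleftrightarrow> (if uncontained x \<and> uncontained y then l (idx x) + 1 < l (idx y)
      else l (idx x) + 1 \<le> l (idx y))"
    proof (cases "uncontained x \<and> uncontained y")
      case True
      then have "R x < L y \<longleftrightarrow> gt (idx x) (idx y)"
        unfolding gt_def using X same_idx_less_uncontained by metis
      then show ?thesis using True l(1)[OF X] by simp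
    next
      case False
      then have "R x < L y \<longleftrightarrow> ge (idx x) (idx y)"
        unfolding ge_def using X same_idx_less by metis
      then show ?thesis using False l(2)[OF X] by auto
    qed
  qed
  then show ?thesis by blast
qed

theorem theorem17:
  fixes X :: "'a set" and lt :: "'a \<Rightarrow> 'a \<Rightarrow> bool"
  assumes "finite X" and "strict_po X lt" and "interval_order X lt"
  shows "unit_OC_interval_order X lt \<longleftrightarrow>
    (\<forall>Q\<in>{four_plus_one, D_star, Z_poset, Y_star, Y_star_star}.
       \<not> contains_induced X lt Q \<and> \<not> contains_induced X lt (dual_poset Q))"
proof
  assume "unit_OC_interval_order X lt"
  then obtain l c where "unit_rep X lt l c"
    unfolding unit_OC_interval_order_iff_unit_rep by blast
  then show "\<forall>Q\<in>{four_plus_one, D_star, Z_poset, Y_star, Y_star_star}.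
       \<not> contains_induced X lt Q \<and> \<not> contains_induced X lt (dual_poset Q)"
    unfolding contains_induced_dual using unit_rep_not_contains unit_rep_dual by blast
next
  assume free: "\<forall>Q\<in>{four_plus_one, D_star, Z_poset, Y_star, Y_star_star}.
       \<not> contains_induced X lt Q \<and> \<not> contains_induced X lt (dual_poset Q)"
  obtain L R :: "'a \<Rightarrow> real" where LR: "\<And>x. x \<in> X \<Longrightarrow> L x \<le> R x"
    and lt: "\<And>x y. x \<in> X \<Longrightarrow> y \<in> X \<Longrightarrow> lt x y \<longleftrightarrow> R x < L y"
    using assms(3) unfolding interval_order_def by blast
  have "forbidden_free_half X L R"
    by (rule forbidden_free_halfI[OF assms(1) LR lt]) (use free in blast)+
  \<comment> \<open>The excluded dual posets are excluded posets of the reversed order, which the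
    reflected endpoints represent.\<close>
  moreover have "forbidden_free_half X (\<lambda>x. - R x) (\<lambda>x. - L x)"
    by (rule forbidden_free_halfI[where lt = "\<lambda>x y. lt y x"])
      (use free assms(1) LR lt in \<open>auto simp: contains_induced_dual\<close>)
  ultimately interpret forbidden_free X L R
    unfolding forbidden_free_def by blast
  obtain l where "unit_rep X (\<lambda>x y. R x < L y) l uncontained"
    using unit_rep_exists by blast
  then have "unit_rep X lt l uncontained"
    unfolding unit_rep_def using lt by simp
  then show "unit_OC_interval_order X lt"
    unfolding unit_OC_interval_order_iff_unit_rep by blast
qed

end
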